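(* Let $d\ge2$, let $s\ge1$ be an integer, and let $H\hookrightarrow C_0^s(\mathbb{R}^d,\mathbb{R})$ be a Hilbert space of scalar-valued functions whose reproducing kernel is $K_H(x,y)=\mathbf{k}_H(x-y)$ with $\mathbf{k}_H(x)=k_H(\|x\|)$ for some function $k_H$ of a nonnegative real variable. Let $V:=\{\nabla f\,|\,f\in H\}$ with inner product $\langle\nabla f_1,\nabla f_2\rangle_V:=\langle f_1,f_2\rangle_H$. Then the reproducing kernel of $V$ is TRI; precisely, it is $K_V(x,y)=\mathbf{k}_V(x-y)$ with, for $x\ne0$, $\mathbf{k}_V(x)=k_V^\parallel(\|x\|)\,\mathrm{Pr}_x^\parallel+k_V^\perp(\|x\|)\,\mathrm{Pr}_x^\perp$, where $$k_V^\parallel(r)=-\frac{d^2k_H}{dr^2}(r)\qquad\text{and}\qquad k_V^\perp(r)=-\frac1r\frac{dk_H}{dr}(r),\qquad r>0.$$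
   Context: $C_0^s(\mathbb{R}^d,\mathbb{R})$ is the Banach space of $C^s$ functions all of whose partial derivatives of order at most $s$ vanish at infinity, with norm $\sum_{|p|\le s}\sup_x|\partial^pu(x)|$; $X\hookrightarrow Y$ means $X\subseteq Y$ with continuous inclusion. The inner product on $V$ is well defined because $f\mapsto\nabla f$ is injective on $H$, and $V$ is a Hilbert space of functions $\mathbb{R}^d\to\mathbb{R}^d$ with continuous point evaluations; its reproducing kernel is the unique $K_V$ with $K_V(\cdot,x)\alpha\in V$ and $\langle K_V(\cdot,x)\alpha,v\rangle_V=\alpha\cdot v(x)$. For $x\ne0$, $\mathrm{Pr}_x^\parallel:=xx^T/\|x\|^2$ and $\mathrm{Pr}_x^\perp:=\mathbb{I}_d-xx^T/\|x\|^2$. A translation-invariant kernel $\mathbf{k}$ is TRI (translation- and rotation-invariant) if $\mathbf{k}(Rx)=R\mathbf{k}(x)R^{-1}$ for all $x\in\mathbb{R}^d$, $R\in O(\mathbb{R}^d)$. *)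

theory Defs
  imports "HOL-Analysis.Analysis" "HOL-Library.Multiset"
begin

section \<open>Hilbert spaces of functions\<close>

definition ip_norm :: "('b \<Rightarrow> 'b \<Rightarrow> real) \<Rightarrow> 'b \<Rightarrow> real" where
  "ip_norm ip f = sqrt (ip f f)"

text \<open>The carrier \<open>F\<close> is a set of honest functions with pointwise operations; the inner product
  \<open>ip\<close> is only constrained on \<open>F\<close>.\<close>

locale hilbert_function_space =
  fixes F :: "('a \<Rightarrow> 'b::real_vector) set"
    and ip :: "('a \<Rightarrow> 'b) \<Rightarrow> ('a \<Rightarrow> 'b) \<Rightarrow> real"
  assumes zero_mem: "(\<lambda>x. 0) \<in> F"
    and add_mem: "\<lbrakk>f \<in> F; g \<in> F\<rbrakk> \<Longrightarrow> (\<lambda>x. f x + g x) \<in> F"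
    and scale_mem: "f \<in> F \<Longrightarrow> (\<lambda>x. c *\<^sub>R f x) \<in> F"
    and ip_sym: "\<lbrakk>f \<in> F; g \<in> F\<rbrakk> \<Longrightarrow> ip f g = ip g f"
    and ip_add: "\<lbrakk>f \<in> F; g \<in> F; h \<in> F\<rbrakk> \<Longrightarrow> ip (\<lambda>x. f x + g x) h = ip f h + ip g h"
    and ip_scale: "\<lbrakk>f \<in> F; h \<in> F\<rbrakk> \<Longrightarrow> ip (\<lambda>x. c *\<^sub>R f x) h = c * ip f h"
    and ip_nonneg: "f \<in> F \<Longrightarrow> 0 \<le> ip f f"
    and ip_definite: "\<lbrakk>f \<in> F; ip f f = 0\<rbrakk> \<Longrightarrow> f = (\<lambda>x. 0)"
    and complete:
      "\<lbrakk>\<And>n. u n \<in> F;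
        \<forall>e>0. \<exists>N. \<forall>m\<ge>N. \<forall>n\<ge>N. ip_norm ip (\<lambda>x. u m x - u n x) < e\<rbrakk>
       \<Longrightarrow> \<exists>f\<in>F. (\<lambda>n::nat. ip_norm ip (\<lambda>x. u n x - f x)) \<longlonglongrightarrow> 0"
begin

lemma diff_mem: "\<lbrakk>f \<in> F; g \<in> F\<rbrakk> \<Longrightarrow> (\<lambda>x. f x - g x) \<in> F"
  using add_mem[of f "\<lambda>x. (-1) *\<^sub>R g x"] scale_mem[of g "-1"] by simp

lemma ip_diff: "\<lbrakk>f \<in> F; g \<in> F; h \<in> F\<rbrakk> \<Longrightarrow> ip (\<lambda>x. f x - g x) h = ip f h - ip g h"
  using ip_add[of f "\<lambda>x. (-1) *\<^sub>R g x" h] scale_mem[of g "-1"] ip_scale[of g h "-1"] by simp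

end


section \<open>Reproducing kernels\<close>

definition scalar_reproducing_kernel ::
  "('a \<Rightarrow> real) set \<Rightarrow> (('a \<Rightarrow> real) \<Rightarrow> ('a \<Rightarrow> real) \<Rightarrow> real) \<Rightarrow> ('a \<Rightarrow> 'a \<Rightarrow> real) \<Rightarrow> bool" where
  "scalar_reproducing_kernel H ip K \<longleftrightarrow>
     (\<forall>x. (\<lambda>y. K y x) \<in> H \<and> (\<forall>f\<in>H. ip (\<lambda>y. K y x) f = f x))"

definition matrix_reproducing_kernel ::
  "('a \<Rightarrow> real^'n) set \<Rightarrow> (('a \<Rightarrow> real^'n) \<Rightarrow> ('a \<Rightarrow> real^'n) \<Rightarrow> real) \<Rightarrow> ('a \<Rightarrow> 'a \<Rightarrow> real^'n^'n) \<Rightarrow> bool"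
  where
  "matrix_reproducing_kernel V ip K \<longleftrightarrow>
     (\<forall>x \<alpha>. (\<lambda>y. K y x *v \<alpha>) \<in> V \<and> (\<forall>v\<in>V. ip (\<lambda>y. K y x *v \<alpha>) v = \<alpha> \<bullet> v x))"

lemma matrix_reproducing_kernel_unique:
  assumes "hilbert_function_space V ip"
    and K: "matrix_reproducing_kernel V ip K" and L: "matrix_reproducing_kernel V ip L"
  shows "K = L"
proof (intro ext)
  fix y x
  interpret hilbert_function_space V ip by fact
  have "K y x *v \<alpha> = L y x *v \<alpha>" for \<alpha>
  proof -
    let ?k = "\<lambda>y. K y x *v \<alpha>" and ?l = "\<lambda>y. L y x *v \<alpha>"
    have k: "?k \<in> V" "\<And>v. v \<in> V \<Longrightarrow> ip ?k v = \<alpha> \<bullet> v x"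
      and l: "?l \<in> V" "\<And>v. v \<in> V \<Longrightarrow> ip ?l v = \<alpha> \<bullet> v x"
      using K L unfolding matrix_reproducing_kernel_def by blast+
    let ?d = "\<lambda>y. ?k y - ?l y"
    have d: "?d \<in> V" using diff_mem k(1) l(1) by blast
    have "ip ?d ?d = ip ?k ?d - ip ?l ?d" by (rule ip_diff[OF k(1) l(1) d])
    also have "\<dots> = 0" using k(2)[OF d] l(2)[OF d] by simp
    finally have "?d = (\<lambda>x. 0)" using ip_definite[OF d] by blast
    from fun_cong[OF this, of y] show ?thesis by simp
  qed
  then show "K y x = L y x" using matrix_eq by blast
qed


section \<open>The spaces \<open>C\<^sub>0\<^sup>s\<close>\<close>

definition partial :: "'n \<Rightarrow> (real^'n \<Rightarrow> real) \<Rightarrow> real^'n \<Rightarrow> real" where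
  "partial i u x = deriv (\<lambda>t. u (x + t *\<^sub>R axis i 1)) 0"

definition has_partial :: "'n \<Rightarrow> (real^'n \<Rightarrow> real) \<Rightarrow> real^'n \<Rightarrow> bool" where
  "has_partial i u x \<longleftrightarrow> (\<lambda>t. u (x + t *\<^sub>R axis i 1)) differentiable (at 0)"

definition partials :: "'n list \<Rightarrow> (real^'n \<Rightarrow> real) \<Rightarrow> real^'n \<Rightarrow> real" where
  "partials is = foldr partial is"

definition C0 :: "nat \<Rightarrow> (real^'n \<Rightarrow> real) set" where
  "C0 s = {u. (\<forall>is i x. length is < s \<longrightarrow> has_partial i (partials is u) x) \<and>
              (\<forall>is. length is \<le> s \<longrightarrow> continuous_on UNIV (partials is u) \<and>
                                   (partials is u \<longlongrightarrow> 0) at_infinity)}"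

text \<open>A multi-index is a multiset of coordinates, \<open>|p|\<close> being its size. For \<open>C\<^sup>s\<close> functions the
  order of differentiation is immaterial, so any enumeration of \<open>p\<close> may be used.\<close>

definition multi_partial :: "'n multiset \<Rightarrow> (real^'n \<Rightarrow> real) \<Rightarrow> real^'n \<Rightarrow> real" where
  "multi_partial p = partials (SOME is. mset is = p)"

definition C0_norm :: "nat \<Rightarrow> (real^'n \<Rightarrow> real) \<Rightarrow> real" where
  "C0_norm s u = (\<Sum>p | size p \<le> s. SUP x. \<bar>multi_partial p u x\<bar>)"

text \<open>Guards against the convention that a sum over an infinite set is 0.\<close>

lemma finite_multi_indices: "finite {p :: 'n::finite multiset. size p \<le> s}"
proof (rule finite_subset)
  show "{p :: 'n multiset. size p \<le> s} \<subseteq> mset ` {is. set is \<subseteq> UNIV \<and> length is \<le> s}"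
  proof
    fix p :: "'n multiset" assume p: "p \<in> {p. size p \<le> s}"
    obtain js where "mset js = p" using ex_mset by blast
    then show "p \<in> mset ` {is. set is \<subseteq> UNIV \<and> length is \<le> s}"
      using p by (intro image_eqI[of _ _ js]) (auto simp flip: size_mset)
  qed
  show "finite (mset ` {is :: 'n list. set is \<subseteq> UNIV \<and> length is \<le> s})"
    by (intro finite_imageI finite_lists_length_le) simp
qed

definition embeds_in_C0 ::
  "nat \<Rightarrow> (real^'n \<Rightarrow> real) set \<Rightarrow> ((real^'n \<Rightarrow> real) \<Rightarrow> (real^'n \<Rightarrow> real) \<Rightarrow> real) \<Rightarrow> bool" where
  "embeds_in_C0 s H ip \<longleftrightarrow> H \<subseteq> C0 s \<and>
     (\<forall>f\<in>H. \<forall>e>0. \<exists>\<delta>>0. \<forall>g\<in>H. ip_norm ip (\<lambda>x. g x - f x) < \<delta> \<longrightarrow>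
                                   C0_norm s (\<lambda>x. g x - f x) < e)"


section \<open>The space of gradients\<close>

definition gradient :: "(real^'n \<Rightarrow> real) \<Rightarrow> real^'n \<Rightarrow> real^'n" where
  "gradient f x = (\<chi> i. partial i f x)"

definition gradient_ip ::
  "(real^'n \<Rightarrow> real) set \<Rightarrow> ((real^'n \<Rightarrow> real) \<Rightarrow> (real^'n \<Rightarrow> real) \<Rightarrow> real) \<Rightarrow>
   (real^'n \<Rightarrow> real^'n) \<Rightarrow> (real^'n \<Rightarrow> real^'n) \<Rightarrow> real" where
  "gradient_ip H ip v w = ip (inv_into H gradient v) (inv_into H gradient w)"

lemma C0_axis:
  assumes "f \<in> C0 s" "1 \<le> s"
  shows "((\<lambda>t. f (x + t *\<^sub>R axis i 1)) has_real_derivative partial i f (x + t *\<^sub>R axis i 1)) (at t)"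
    and "(f \<longlongrightarrow> 0) at_infinity"
proof -
  have "\<forall>is i x. length is < s \<longrightarrow> has_partial i (partials is f) x"
    and "\<forall>is. length is \<le> s \<longrightarrow> (partials is f \<longlongrightarrow> 0) at_infinity"
    using assms(1) unfolding C0_def by blast+
  then have "has_partial i (partials [] f) (x + t *\<^sub>R axis i 1)"
    and "(partials [] f \<longlongrightarrow> 0) at_infinity"
    using assms(2) by (metis list.size(3) less_eq_Suc_le One_nat_def, metis list.size(3) le0)
  then have hp: "has_partial i f (x + t *\<^sub>R axis i 1)" and lim: "(f \<longlongrightarrow> 0) at_infinity"
    by (simp_all add: partials_def)
  show "(f \<longlongrightarrow> 0) at_infinity" by fact
  have "((\<lambda>h. f (x + t *\<^sub>R axis i 1 + h *\<^sub>R axis i 1)) has_real_derivative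
         partial i f (x + t *\<^sub>R axis i 1)) (at 0)"
    using hp unfolding has_partial_def partial_def by (simp add: DERIV_deriv_iff_real_differentiable)
  then have "((\<lambda>h. f (x + (t + h) *\<^sub>R axis i 1)) has_real_derivative
         partial i f (x + t *\<^sub>R axis i 1)) (at 0)"
    by (simp add: algebra_simps)
  then show "((\<lambda>t. f (x + t *\<^sub>R axis i 1)) has_real_derivative
         partial i f (x + t *\<^sub>R axis i 1)) (at t)"
    using DERIV_shift[of "\<lambda>t. f (x + t *\<^sub>R axis i 1)" _ 0 t] by (simp add: add.commute)
qed

lemma inj_on_gradient:
  fixes H :: "(real^'n \<Rightarrow> real) set"
  assumes "H \<subseteq> C0 s" "1 \<le> s"
  shows "inj_on gradient H"
proof (intro inj_onI ext)
  fix f g :: "real^'n \<Rightarrow> real" and x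
  assume fg: "f \<in> H" "g \<in> H" "gradient f = gradient g"
  fix i :: 'n
  have C: "f \<in> C0 s" "g \<in> C0 s" using fg assms by auto
  have p: "partial i f y = partial i g y" for y
    using arg_cong[OF fun_cong[OF fg(3), of y], of "\<lambda>v. v $ i"] by (simp add: gradient_def)
  let ?h = "\<lambda>t. f (x + t *\<^sub>R axis i 1) - g (x + t *\<^sub>R axis i 1)"
  have "(?h has_real_derivative 0) (at t)" for t
    using DERIV_diff[OF C0_axis(1)[OF C(1) assms(2), of x i t] C0_axis(1)[OF C(2) assms(2), of x i t]]
    by (simp add: p)
  then have const: "?h t = ?h 0" for t by (intro DERIV_isconst_all) blast
  have at_inf: "filterlim (\<lambda>t::real. x + t *\<^sub>R axis i 1) at_infinity at_top"
  proof -
    have "filterlim (\<lambda>t::real. norm (t *\<^sub>R axis i (1::real))) at_top at_top"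
      using filterlim_abs_real by simp
    then have "filterlim (\<lambda>t::real. t *\<^sub>R axis i (1::real)) at_infinity at_top"
      by (rule filterlim_norm_at_top_imp_at_infinity)
    then show ?thesis by (rule tendsto_add_filterlim_at_infinity[OF tendsto_const])
  qed
  have "(?h \<longlongrightarrow> 0 - 0) at_top"
    by (intro tendsto_diff filterlim_compose[OF C0_axis(2)[OF C(1) assms(2)] at_inf]
        filterlim_compose[OF C0_axis(2)[OF C(2) assms(2)] at_inf])
  moreover have "(?h \<longlongrightarrow> ?h 0) at_top"
    by (rule Lim_transform_eventually[OF tendsto_const])
      (rule always_eventually, use const in metis)
  ultimately have "?h 0 = 0 - 0" by (intro tendsto_unique[of at_top ?h]) simp_all
  then show "f x = g x" by simp
qed

lemma gradient_ip_gradient: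
  assumes "H \<subseteq> C0 s" "1 \<le> s" "f \<in> H" "g \<in> H"
  shows "gradient_ip H ip (gradient f) (gradient g) = ip f g"
  using inj_on_gradient[OF assms(1,2)] assms(3,4) by (simp add: gradient_ip_def)

lemma gradient_linear:
  assumes "f \<in> C0 s" "g \<in> C0 s" "1 \<le> s"
  shows "gradient (\<lambda>x. f x + g x) = (\<lambda>x. gradient f x + gradient g x)"
    and "gradient (\<lambda>x. f x - g x) = (\<lambda>x. gradient f x - gradient g x)"
    and "gradient (\<lambda>x. c *\<^sub>R f x) = (\<lambda>x. c *\<^sub>R gradient f x)"
proof -
  have f: "((\<lambda>t. f (x + t *\<^sub>R axis i 1)) has_real_derivative partial i f x) (at 0)"
    and g: "((\<lambda>t. g (x + t *\<^sub>R axis i 1)) has_real_derivative partial i g x) (at 0)" for x i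
    using C0_axis(1)[OF assms(1,3), of x i 0] C0_axis(1)[OF assms(2,3), of x i 0] by simp_all
  have "partial i (\<lambda>x. f x + g x) x = partial i f x + partial i g x"
    and "partial i (\<lambda>x. f x - g x) x = partial i f x - partial i g x"
    and "partial i (\<lambda>x. c * f x) x = c * partial i f x" for x i
    using DERIV_imp_deriv[OF DERIV_add[OF f g]] DERIV_imp_deriv[OF DERIV_diff[OF f g]]
      DERIV_imp_deriv[OF DERIV_cmult[OF f]] by (simp_all add: partial_def)
  then show "gradient (\<lambda>x. f x + g x) = (\<lambda>x. gradient f x + gradient g x)"
    and "gradient (\<lambda>x. f x - g x) = (\<lambda>x. gradient f x - gradient g x)"
    and "gradient (\<lambda>x. c *\<^sub>R f x) = (\<lambda>x. c *\<^sub>R gradient f x)"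
    by (simp_all add: gradient_def vec_eq_iff fun_eq_iff)
qed

lemma hilbert_function_space_gradient:
  fixes H :: "(real^'n \<Rightarrow> real) set"
  assumes "hilbert_function_space H ip" "H \<subseteq> C0 s" "1 \<le> s"
  shows "hilbert_function_space (gradient ` H) (gradient_ip H ip)"
proof -
  interpret H: hilbert_function_space H ip by fact
  note ip = gradient_ip_gradient[OF assms(2,3)]
  have C: "f \<in> C0 s" if "f \<in> H" for f using that assms(2) by blast
  have add: "(\<lambda>x. gradient f x + gradient g x) = gradient (\<lambda>x. f x + g x)"
    and diff: "(\<lambda>x. gradient f x - gradient g x) = gradient (\<lambda>x. f x - g x)"
    and scale: "(\<lambda>x. c *\<^sub>R gradient f x) = gradient (\<lambda>x. c *\<^sub>R f x)"
    if "f \<in> H" "g \<in> H" for f g c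
    using gradient_linear[OF C C assms(3)] that by auto
  have zero: "(\<lambda>x. 0) = gradient (\<lambda>x::real^'n. 0)"
    using scale[OF H.zero_mem H.zero_mem, of 0] by simp
  have norm: "ip_norm (gradient_ip H ip) (\<lambda>x. gradient f x - gradient g x)
                = ip_norm ip (\<lambda>x. f x - g x)"
    if "f \<in> H" "g \<in> H" for f g
    using that by (simp add: diff ip_norm_def ip H.diff_mem)
  show ?thesis
  proof
    show "(\<lambda>x. 0) \<in> gradient ` H"
      unfolding zero using H.zero_mem by blast
  next
    fix v w assume "v \<in> gradient ` H" "w \<in> gradient ` H"
    then show "(\<lambda>x. v x + w x) \<in> gradient ` H" by (auto simp: add intro!: H.add_mem imageI)
  next
    fix v c assume "v \<in> gradient ` H"
    then show "(\<lambda>x. c *\<^sub>R v x) \<in> gradient ` H"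
      using H.scale_mem by (auto simp: scale simp del: real_scaleR_def)
  next
    fix v w assume "v \<in> gradient ` H" "w \<in> gradient ` H"
    then show "gradient_ip H ip v w = gradient_ip H ip w v" by (auto simp: ip H.ip_sym)
  next
    fix u v w assume "u \<in> gradient ` H" "v \<in> gradient ` H" "w \<in> gradient ` H"
    then show "gradient_ip H ip (\<lambda>x. u x + v x) w = gradient_ip H ip u w + gradient_ip H ip v w"
      by (auto simp: add ip H.add_mem H.ip_add)
  next
    fix v w c assume "v \<in> gradient ` H" "w \<in> gradient ` H"
    then show "gradient_ip H ip (\<lambda>x. c *\<^sub>R v x) w = c * gradient_ip H ip v w"
      using H.scale_mem H.ip_scale by (auto simp: scale ip simp del: real_scaleR_def)
  next
    fix v assume "v \<in> gradient ` H"
    then show "0 \<le> gradient_ip H ip v v" by (auto simp: ip H.ip_nonneg)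
  next
    fix v assume "v \<in> gradient ` H" "gradient_ip H ip v v = 0"
    then obtain f where f: "f \<in> H" "v = gradient f" "ip f f = 0" by (auto simp: ip)
    then have "f = (\<lambda>x. 0)" using H.ip_definite by blast
    then show "v = (\<lambda>x. 0)" using f(2) zero by simp
  next
    fix u :: "nat \<Rightarrow> real^'n \<Rightarrow> real^'n"
    assume "\<And>n. u n \<in> gradient ` H"
      and cau: "\<forall>e>0. \<exists>N. \<forall>m\<ge>N. \<forall>n\<ge>N.
                  ip_norm (gradient_ip H ip) (\<lambda>x. u m x - u n x) < e"
    then have "\<forall>n. \<exists>f\<in>H. u n = gradient f" by blast
    then obtain w where w: "\<And>n. w n \<in> H" "\<And>n. u n = gradient (w n)" by metis
    have "\<forall>e>0. \<exists>N. \<forall>m\<ge>N. \<forall>n\<ge>N. ip_norm ip (\<lambda>x. w m x - w n x) < e"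
      using cau by (simp add: w norm)
    from H.complete[OF w(1) this]
    obtain f where f: "f \<in> H" "(\<lambda>n. ip_norm ip (\<lambda>x. w n x - f x)) \<longlonglongrightarrow> 0" by blast
    then have "(\<lambda>n. ip_norm (gradient_ip H ip) (\<lambda>x. u n x - gradient f x)) \<longlonglongrightarrow> 0"
      by (simp add: w norm)
    then show "\<exists>v\<in>gradient ` H. (\<lambda>n. ip_norm (gradient_ip H ip) (\<lambda>x. u n x - v x)) \<longlonglongrightarrow> 0"
      using f(1) by blast
  qed
qed


section \<open>Rotation invariance\<close>

definition Pr_par :: "real^'n \<Rightarrow> real^'n^'n" where
  "Pr_par x = (\<chi> i j. x $ i * x $ j / (norm x)\<^sup>2)"

definition Pr_perp :: "real^'n \<Rightarrow> real^'n^'n" where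
  "Pr_perp x = mat 1 - Pr_par x"

text \<open>A translation-invariant kernel \<open>K x y = k (x - y)\<close> is represented by its one-argument
  function \<open>k\<close>.\<close>

definition TRI :: "(real^'n \<Rightarrow> real^'n^'n) \<Rightarrow> bool" where
  "TRI k \<longleftrightarrow> (\<forall>x R. orthogonal_matrix R \<longrightarrow> k (R *v x) = R ** k x ** matrix_inv R)"

end

theory Submission
  imports Defs
begin

text \<open>Evaluation of a directional derivative is a bounded functional on \<open>H\<close>, so by Riesz it is
  represented by some \<open>G \<in> H\<close>; testing against the kernel functions shows that \<open>G\<close> is a directional
  derivative of a reflected translate of \<open>k x = k_H (norm x)\<close>. Since \<open>G\<close> lies in \<open>C\<^sub>0\<^sup>s\<close> with
  \<open>s \<ge> 1\<close>, the function \<open>k\<close> is twice continuously differentiable and \<open>k_V\<close> is minus its Hessian,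
  which is computed away from the origin by the chain rule. Rotation invariance at the origin
  follows by continuity.\<close>

section \<open>Riesz representation\<close>

context hilbert_function_space
begin

lemma ip_zero_left: "h \<in> F \<Longrightarrow> ip (\<lambda>x. 0) h = 0"
  using ip_scale[of h h 0] by simp

lemma ip_norm_scale: "f \<in> F \<Longrightarrow> ip_norm ip (\<lambda>x. c *\<^sub>R f x) = \<bar>c\<bar> * ip_norm ip f"
  using ip_scale[of f "\<lambda>x. c *\<^sub>R f x" c] ip_sym[of f "\<lambda>x. c *\<^sub>R f x"] ip_scale[of f f c] scale_mem[of f c]
  by (simp add: ip_norm_def real_sqrt_mult flip: mult.assoc)

lemma ip_norm_sq: "f \<in> F \<Longrightarrow> (ip_norm ip f)\<^sup>2 = ip f f"
  by (simp add: ip_norm_def ip_nonneg)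

text \<open>A quadratic polynomial in \<open>c\<close>: its minimum yields Cauchy-Schwarz, and it
  gives the expansion of the energy in the Riesz argument.\<close>

lemma ip_combination:
  assumes "f \<in> F" "g \<in> F"
  shows "ip (\<lambda>x. f x + c *\<^sub>R g x) (\<lambda>x. f x + c *\<^sub>R g x) = ip f f + 2 * c * ip f g + c\<^sup>2 * ip g g"
proof -
  let ?g = "\<lambda>x. c *\<^sub>R g x" and ?h = "\<lambda>x. f x + c *\<^sub>R g x"
  have m: "?g \<in> F" "?h \<in> F" using assms scale_mem add_mem by auto
  have "ip w ?h = ip w f + c * ip w g" if "w \<in> F" for w
    using ip_add[OF assms(1) m(1) that] ip_scale[OF assms(2) that, of c]
      ip_sym[OF that m(2)] ip_sym[OF that assms(1)] ip_sym[OF that assms(2)] by simp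
  then have "ip ?h ?h = (ip f f + c * ip f g) + c * (ip g f + c * ip g g)"
    using ip_add[OF assms(1) m(1) m(2)] ip_scale[OF assms(2) m(2), of c] assms by simp
  then show ?thesis using ip_sym[OF assms] by (simp add: power2_eq_square algebra_simps)
qed

lemma ip_Cauchy_Schwarz:
  assumes "f \<in> F" "g \<in> F"
  shows "\<bar>ip f g\<bar> \<le> ip_norm ip f * ip_norm ip g"
proof (cases "ip g g = 0")
  case True
  then have "g = (\<lambda>x. 0)" using ip_definite assms(2) by blast
  then show ?thesis
    using ip_zero_left[OF assms(1)] ip_sym[OF assms(1) zero_mem] assms
    by (simp add: ip_norm_def ip_nonneg)
next
  case False
  then have pos: "0 < ip g g" using ip_nonneg[OF assms(2)] by simp
  \<comment> \<open>The minimiser of the quadratic from \<open>ip_combination\<close>.\<close>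
  define c where "c = - ip f g / ip g g"
  have "0 \<le> ip f f + 2 * c * ip f g + c\<^sup>2 * ip g g"
    using ip_combination[OF assms, of c] ip_nonneg[OF add_mem[OF assms(1) scale_mem[OF assms(2), of c]]]
    by simp
  also have "\<dots> = ip f f - (ip f g)\<^sup>2 / ip g g"
    using pos by (simp add: c_def power2_eq_square field_simps)
  finally have "(ip f g)\<^sup>2 \<le> ip f f * ip g g" using pos by (simp add: field_simps)
  then have "sqrt ((ip f g)\<^sup>2) \<le> sqrt (ip f f * ip g g)" by (rule real_sqrt_le_mono)
  then show ?thesis by (simp add: ip_norm_def real_sqrt_mult)
qed

text \<open>The representer minimises the energy \<open>\<langle>f, f\<rangle>/2 - L f\<close>; a minimising sequence is Cauchy by the
  parallelogram identity.\<close>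

lemma riesz_representation:
  fixes L :: "('a \<Rightarrow> 'b) \<Rightarrow> real"
  assumes add: "\<And>f g. \<lbrakk>f \<in> F; g \<in> F\<rbrakk> \<Longrightarrow> L (\<lambda>x. f x + g x) = L f + L g"
    and scale: "\<And>f c. f \<in> F \<Longrightarrow> L (\<lambda>x. c *\<^sub>R f x) = c * L f"
    and bound: "\<And>f. f \<in> F \<Longrightarrow> \<bar>L f\<bar> \<le> C * ip_norm ip f"
  obtains g where "g \<in> F" "\<And>f. f \<in> F \<Longrightarrow> ip g f = L f"
proof -
  define J where "J f = ip f f / 2 - L f" for f
  \<comment> \<open>An exact second-order Taylor expansion, since \<open>J\<close> is quadratic; the
    coefficient of \<open>c\<close> is the derivative of \<open>J\<close> at \<open>f\<close> along
    \<open>g\<close>.\<close>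
  have J_comb: "J (\<lambda>x. f x + c *\<^sub>R g x) = J f + c * (ip f g - L g) + c\<^sup>2 * ip g g / 2"
    if "f \<in> F" "g \<in> F" for f g c
    using ip_combination[OF that, of c] add[OF that(1) scale_mem[OF that(2), of c]] scale[OF that(2), of c]
    by (simp add: J_def algebra_simps add_divide_distrib)
  \<comment> \<open>Completing the square in \<open>ip_norm ip f\<close>, with \<open>L f\<close> at
    most \<open>C * ip_norm ip f\<close>.\<close>
  have J_lower: "- C\<^sup>2 / 2 \<le> J f" if "f \<in> F" for f
  proof -
    have "0 \<le> (ip_norm ip f - C)\<^sup>2 / 2" by simp
    also have "\<dots> = ip f f / 2 - C * ip_norm ip f + C\<^sup>2 / 2"
      by (simp add: power2_diff ip_norm_sq[OF that] field_simps)
    finally show ?thesis using bound[OF that] by (simp add: J_def)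
  qed
  define m where "m = Inf (J ` F)"
  have bdd: "bdd_below (J ` F)" using J_lower by (intro bdd_belowI2) blast
  have m_le: "m \<le> J f" if "f \<in> F" for f
    unfolding m_def using bdd that by (intro cInf_lower) auto
  have "\<exists>f\<in>F. J f < m + 1 / real (Suc n)" for n
  proof -
    have "Inf (J ` F) < m + 1 / real (Suc n)" by (simp add: m_def)
    moreover have "J ` F \<noteq> {}" using zero_mem by blast
    ultimately show ?thesis using cInf_lessD[of "J ` F" "m + 1 / real (Suc n)"] by auto
  qed
  then obtain u where u: "\<And>n. u n \<in> F" "\<And>n. J (u n) < m + 1 / real (Suc n)" by metis
  \<comment> \<open>The midpoint \<open>g + d/2\<close> has energy at least \<open>m\<close>;
    eliminating the linear term between its expansion and that of \<open>f = g + d\<close> leaves a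
    bound on \<open>ip d d\<close>.\<close>
  have diff_sq: "ip (\<lambda>x. f x - g x) (\<lambda>x. f x - g x) \<le> 4 * (J f - m) + 4 * (J g - m)"
    if "f \<in> F" "g \<in> F" for f g
  proof -
    define d where "d = (\<lambda>x. f x - g x)"
    have d: "d \<in> F" unfolding d_def using diff_mem that by blast
    have "(\<lambda>x. g x + 1 *\<^sub>R d x) = f" by (auto simp: d_def)
    then have "J f = J g + (ip g d - L d) + ip d d / 2"
      using J_comb[OF that(2) d, of 1] by simp
    moreover have "m \<le> J g + (ip g d - L d) / 2 + ip d d / 8"
      using m_le[OF add_mem[OF that(2) scale_mem[OF d, of "1/2"]]] J_comb[OF that(2) d, of "1/2"]
      by (simp add: power2_eq_square)
    ultimately have "ip d d \<le> 4 * (J f - m) + 4 * (J g - m)" by argo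
    then show ?thesis by (simp only: d_def)
  qed
  have cauchy: "\<exists>N. \<forall>m\<ge>N. \<forall>n\<ge>N. ip_norm ip (\<lambda>x. u m x - u n x) < e" if "0 < e" for e :: real
  proof -
    \<comment> \<open>Makes both energy gaps smaller than \<open>e^2 / 8\<close>, so that
      \<open>diff_sq\<close> gives less than \<open>e^2\<close>.\<close>
    obtain N where N: "8 / e\<^sup>2 < real N" using reals_Archimedean2 by blast
    have small: "J (u n) - m < e\<^sup>2 / 8" if "N \<le> n" for n
    proof -
      have "8 / e\<^sup>2 < real (Suc n)" using N that by simp
      then have "1 / real (Suc n) < e\<^sup>2 / 8" using \<open>0 < e\<close> by (simp add: field_simps)
      then show ?thesis using u(2)[of n] by simp
    qed
    have "ip_norm ip (\<lambda>x. u k x - u n x) < e" if "N \<le> k" "N \<le> n" for k n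
    proof -
      have "ip (\<lambda>x. u k x - u n x) (\<lambda>x. u k x - u n x) < e\<^sup>2"
        using diff_sq[OF u(1) u(1), of k n] small[OF that(1)] small[OF that(2)] by simp
      then show ?thesis using \<open>0 < e\<close> by (simp add: ip_norm_def real_less_lsqrt)
    qed
    then show ?thesis by blast
  qed
  have "\<exists>g\<in>F. (\<lambda>n. ip_norm ip (\<lambda>x. u n x - g x)) \<longlonglongrightarrow> 0"
    using cauchy by (intro complete u(1)) simp
  then obtain g where g: "g \<in> F" "(\<lambda>n. ip_norm ip (\<lambda>x. u n x - g x)) \<longlonglongrightarrow> 0"
    by blast
  \<comment> \<open>Continuity of \<open>J\<close> at \<open>g\<close>: expand at \<open>g\<close>
    in the direction \<open>u n - g\<close> and bound the linear part by Cauchy-Schwarz and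
    \<open>bound\<close>.\<close>
  have lim: "(\<lambda>n. J (u n) - J g) \<longlonglongrightarrow> 0"
  proof -
    let ?d = "\<lambda>n x. u n x - g x"
    have d: "?d n \<in> F" for n using diff_mem u g by blast
    have eq: "J (u n) - J g = (ip g (?d n) - L (?d n)) + ip (?d n) (?d n) / 2" for n
    proof -
      have "(\<lambda>x. g x + 1 *\<^sub>R ?d n x) = u n" by auto
      then show ?thesis using J_comb[OF g(1) d, of 1 n] by simp
    qed
    have "\<bar>J (u n) - J g\<bar> \<le> (ip_norm ip g + C) * ip_norm ip (?d n) + (ip_norm ip (?d n))\<^sup>2 / 2" for n
      using ip_Cauchy_Schwarz[OF g(1) d, of n] bound[OF d, of n] ip_norm_sq[OF d, of n]
        ip_nonneg[OF d, of n] unfolding eq by (simp add: algebra_simps abs_le_iff)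
    moreover have "(\<lambda>n. (ip_norm ip g + C) * ip_norm ip (?d n) + (ip_norm ip (?d n))\<^sup>2 / 2)
        \<longlonglongrightarrow> (ip_norm ip g + C) * 0 + 0\<^sup>2 / 2"
      by (intro tendsto_intros g(2)) simp
    ultimately show ?thesis
      by (intro Lim_null_comparison[of "\<lambda>n. J (u n) - J g"]) (auto simp: always_eventually)
  qed
  have "(\<lambda>n. J (u n) - J g + J g) \<longlonglongrightarrow> 0 + J g" by (intro tendsto_intros lim)
  moreover have "(\<lambda>n. m + 1 / real (Suc n)) \<longlonglongrightarrow> m + 0"
    by (intro tendsto_intros LIMSEQ_Suc lim_1_over_n)
  ultimately have J_g: "J g \<le> m"
    using u(2) by (intro LIMSEQ_le[of "\<lambda>n. J (u n)" "J g"]) (auto intro: less_imp_le)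
  have derivative_zero: "ip g f = L f" if f: "f \<in> F" for f
  proof -
    \<comment> \<open>As \<open>g\<close> is a minimiser, this holds for every real
      \<open>c\<close>, which forces the linear coefficient to vanish.\<close>
    have *: "0 \<le> c * (ip g f - L f) + c\<^sup>2 * ip f f / 2" for c
    proof -
      define h where "h = (\<lambda>x. g x + c *\<^sub>R f x)"
      have h: "h \<in> F" unfolding h_def using g f add_mem scale_mem by blast
      have "J g \<le> J h" using J_g m_le[OF h] by simp
      then show ?thesis using J_comb[OF g(1) f, of c] by (simp add: h_def)
    qed
    show ?thesis
    proof (rule ccontr)
      assume "ip g f \<noteq> L f"
      define a where "a = ip g f - L f"
      define q where "q = ip f f"
      have a: "a \<noteq> 0" "0 \<le> q" using \<open>ip g f \<noteq> L f\<close> ip_nonneg[OF f] by (auto simp: a_def q_def)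
      \<comment> \<open>A step against the sign of \<open>a\<close>, short enough for the linear
        term to dominate; \<open>q + 1\<close> is a positive denominator for every \<open>q\<close>
        here.\<close>
      have "0 \<le> (- a / (q + 1)) * a + (- a / (q + 1))\<^sup>2 * q / 2"
        using *[of "- a / (q + 1)"] by (simp add: a_def q_def)
      also have "\<dots> = - (a\<^sup>2 * (q + 2)) / (2 * (q + 1)\<^sup>2)"
        using a by (simp add: power2_eq_square divide_simps) (simp add: algebra_simps)
      also have "\<dots> < 0" using a by (intro divide_neg_pos) (simp_all add: mult_pos_pos)
      finally show False by simp
    qed
  qed
  then show ?thesis using that g(1) by blast
qed

end


section \<open>Bounded evaluation of gradients\<close>

lemma C0_partials:
  assumes "u \<in> C0 s" "length is \<le> s"
  shows "continuous_on UNIV (partials is u)" "(partials is u \<longlongrightarrow> 0) at_infinity"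
  using assms unfolding C0_def by blast+

lemma C0_partial_continuous:
  assumes "u \<in> C0 s" "1 \<le> s"
  shows "continuous_on UNIV (partial i u)"
  using C0_partials(1)[OF assms(1), of "[i]"] assms(2) by (simp add: partials_def)

text \<open>Compactness bounds \<open>g\<close> on a large ball, and outside it the limit gives the
  bound 1. This makes the suprema in \<open>C0_norm\<close> meaningful.\<close>

lemma continuous_vanishing_bdd_above:
  fixes g :: "real^'n \<Rightarrow> real"
  assumes "continuous_on UNIV g" "(g \<longlongrightarrow> 0) at_infinity"
  shows "bdd_above (range (\<lambda>x. \<bar>g x\<bar>))"
proof -
  obtain B where B: "\<And>x. B \<le> norm x \<Longrightarrow> \<bar>g x\<bar> < 1"
    using tendstoD[OF assms(2), of 1] by (auto simp: eventually_at_infinity dist_norm)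
  have "bounded (g ` cball 0 B)"
    by (intro compact_imp_bounded compact_continuous_image continuous_on_subset[OF assms(1)]) auto
  then obtain M where "\<forall>x\<in>cball 0 B. \<bar>g x\<bar> \<le> M"
    unfolding bounded_iff by auto
  then have M: "\<bar>g x\<bar> \<le> M" if "norm x \<le> B" for x using that by simp
  have "\<bar>g x\<bar> \<le> max M 1" for x
    using B[of x] M[of x] by (cases "norm x \<le> B") auto
  then show ?thesis by (intro bdd_aboveI2) blast
qed

text \<open>The supremum of this partial derivative is the summand of \<open>C0_norm\<close> at the
  multi-index \<open>{#i#}\<close>, and all summands are nonnegative.\<close>

lemma abs_partial_le_C0_norm:
  assumes "u \<in> C0 s" "1 \<le> s"
  shows "\<bar>partial i u x\<bar> \<le> C0_norm s u"
proof -
  have bdd: "bdd_above (range (\<lambda>x. \<bar>multi_partial p u x\<bar>))" if "size p \<le> s" for p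
  proof -
    have "mset (SOME is. mset is = p) = p" using ex_mset by (rule someI_ex)
    then have "length (SOME is. mset is = p) \<le> s" using that by (metis size_mset)
    then show ?thesis unfolding multi_partial_def
      by (intro continuous_vanishing_bdd_above C0_partials[OF assms(1)])
  qed
  \<comment> \<open>A singleton multiset has the only enumeration \<open>[i]\<close>, so the choice
    is determined.\<close>
  have single: "multi_partial {#i#} u = partial i u" by (simp add: multi_partial_def partials_def)
  have "\<bar>partial i u x\<bar> \<le> (SUP x. \<bar>multi_partial {#i#} u x\<bar>)"
    using cSUP_upper[OF UNIV_I bdd, of "{#i#}" x] assms(2) by (simp add: single)
  also have "\<dots> \<le> C0_norm s u"
    unfolding C0_norm_def
  proof (rule member_le_sum)
    show "{#i#} \<in> {p. size p \<le> s}" using assms(2) by simp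
    show "finite {p :: 'a multiset. size p \<le> s}" by (rule finite_multi_indices)
  next
    fix p assume "p \<in> {p. size p \<le> s} - {{#i#}}"
    then have "\<bar>multi_partial p u 0\<bar> \<le> (SUP x. \<bar>multi_partial p u x\<bar>)"
      by (intro cSUP_upper bdd) auto
    then show "0 \<le> (SUP x. \<bar>multi_partial p u x\<bar>)" by linarith
  qed
  finally show ?thesis .
qed

text \<open>Continuity of the inclusion at 0 gives a ball mapped into the unit ball of
  \<open>C0_norm\<close>; homogeneity turns this into a linear bound, uniform in
  \<open>x\<close>.\<close>

lemma gradient_evaluation_bounded:
  fixes H :: "(real^'n \<Rightarrow> real) set"
  assumes "hilbert_function_space H ip" "embeds_in_C0 s H ip" "1 \<le> s"
  obtains C where "\<And>f x. f \<in> H \<Longrightarrow> norm (gradient f x) \<le> C * ip_norm ip f"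
proof -
  interpret hilbert_function_space H ip by fact
  have sub: "H \<subseteq> C0 s" using assms(2) by (simp add: embeds_in_C0_def)
  have "\<forall>e>0. \<exists>\<delta>>0. \<forall>g\<in>H. ip_norm ip (\<lambda>x. g x - 0) < \<delta> \<longrightarrow> C0_norm s (\<lambda>x. g x - 0) < e"
    by (rule bspec[OF conjunct2[OF assms(2)[unfolded embeds_in_C0_def]] zero_mem])
  from this[rule_format, OF zero_less_one] obtain \<delta> where \<delta>: "0 < \<delta>" "\<And>g. \<lbrakk>g \<in> H; ip_norm ip g < \<delta>\<rbrakk> \<Longrightarrow> C0_norm s g < 1" by auto
  have part: "\<bar>partial i f x\<bar> \<le> 2 / \<delta> * ip_norm ip f" if f: "f \<in> H" for f i x
  proof (cases "ip f f = 0")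
    case True
    then have "f = (\<lambda>x. 0)" using ip_definite f by blast
    then show ?thesis using True by (simp add: partial_def ip_norm_def)
  next
    case False
    then have pos: "0 < ip_norm ip f" using ip_nonneg[OF f] by (simp add: ip_norm_def)
    \<comment> \<open>Rescales \<open>f\<close> to norm \<open>\<delta> / 2\<close>, strictly inside
      the ball.\<close>
    define c where "c = \<delta> / (2 * ip_norm ip f)"
    have c: "0 < c" using \<delta> pos by (simp add: c_def)
    have cf: "(\<lambda>x. c *\<^sub>R f x) \<in> H" using scale_mem f by blast
    have "ip_norm ip (\<lambda>x. c *\<^sub>R f x) < \<delta>"
      using ip_norm_scale[OF f, of c] c pos \<delta> by (simp add: c_def)
    then have "\<bar>partial i (\<lambda>x. c *\<^sub>R f x) x\<bar> < 1"
      using \<delta>(2)[OF cf] abs_partial_le_C0_norm[of "\<lambda>x. c *\<^sub>R f x" s i x] cf sub assms(3) by fastforce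
    moreover have "partial i (\<lambda>x. c *\<^sub>R f x) x = c * partial i f x"
      using arg_cong[OF fun_cong[OF gradient_linear(3)[of f s f c], of x], of "\<lambda>v. v $ i"] f sub assms(3)
      by (auto simp: gradient_def)
    ultimately have "c * \<bar>partial i f x\<bar> < 1" using c by (simp add: abs_mult)
    then show ?thesis using c pos \<delta> by (simp add: c_def field_simps)
  qed
  have "norm (gradient f x) \<le> real CARD('n) * (2 / \<delta>) * ip_norm ip f" if "f \<in> H" for f x
  proof -
    have "norm (gradient f x) \<le> (\<Sum>i\<in>UNIV. \<bar>gradient f x $ i\<bar>)" by (rule norm_le_l1_cart)
    also have "\<dots> \<le> (\<Sum>i\<in>(UNIV::'n set). 2 / \<delta> * ip_norm ip f)"
      using part[OF that] by (intro sum_mono) (simp add: gradient_def)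
    finally show ?thesis by (simp add: mult.assoc)
  qed
  then show ?thesis using that by blast
qed

lemma gradient_representer:
  fixes H :: "(real^'n \<Rightarrow> real) set"
  assumes "hilbert_function_space H ip" "embeds_in_C0 s H ip" "1 \<le> s"
  obtains g where "g \<in> H" "\<And>f. f \<in> H \<Longrightarrow> ip g f = \<alpha> \<bullet> gradient f x"
proof -
  interpret hilbert_function_space H ip by fact
  have C: "f \<in> C0 s" if "f \<in> H" for f using assms(2) that by (auto simp: embeds_in_C0_def)
  obtain B where B: "\<And>f x. f \<in> H \<Longrightarrow> norm (gradient f x) \<le> B * ip_norm ip f"
    using gradient_evaluation_bounded[OF assms] by blast
  show ?thesis
  proof (rule riesz_representation[of "\<lambda>f. \<alpha> \<bullet> gradient f x" "norm \<alpha> * B"])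
    fix f g assume "f \<in> H" "g \<in> H"
    then show "\<alpha> \<bullet> gradient (\<lambda>x. f x + g x) x = \<alpha> \<bullet> gradient f x + \<alpha> \<bullet> gradient g x"
      by (simp add: gradient_linear(1)[OF C C assms(3)] inner_add_right)
  next
    fix f c assume "f \<in> H"
    then show "\<alpha> \<bullet> gradient (\<lambda>x. c *\<^sub>R f x) x = c * (\<alpha> \<bullet> gradient f x)"
      by (simp add: gradient_linear(3)[OF C C assms(3)] del: real_scaleR_def)
  next
    fix f assume "f \<in> H"
    have "\<bar>\<alpha> \<bullet> gradient f x\<bar> \<le> norm \<alpha> * norm (gradient f x)" by (rule Cauchy_Schwarz_ineq2)
    also have "\<dots> \<le> norm \<alpha> * (B * ip_norm ip f)" using B[OF \<open>f \<in> H\<close>] by (intro mult_left_mono) auto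
    finally show "\<bar>\<alpha> \<bullet> gradient f x\<bar> \<le> norm \<alpha> * B * ip_norm ip f" by (simp add: mult.assoc)
  qed (use that in blast)
qed

lemma partial_translate: "partial i (\<lambda>z. f (z - y)) x = partial i f (x - y)"
  by (simp add: partial_def algebra_simps)


section \<open>Derivatives of radial functions\<close>

lemma norm_axis_derivative:
  fixes x :: "real^'n"
  assumes "x \<noteq> 0"
  shows "((\<lambda>t. norm (x + t *\<^sub>R axis i 1)) has_real_derivative x $ i / norm x) (at 0)"
proof -
  have eq: "norm (x + t *\<^sub>R axis i 1) = sqrt ((norm x)\<^sup>2 + 2 * t * x $ i + t\<^sup>2)" for t
    by (simp add: norm_eq_sqrt_inner inner_add_left inner_add_right inner_axis inner_axis'
        power2_eq_square algebra_simps)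
  have "((\<lambda>t. sqrt ((norm x)\<^sup>2 + 2 * t * x $ i + t\<^sup>2)) has_real_derivative x $ i / norm x) (at 0)"
    using assms by (auto intro!: derivative_eq_intros simp: field_simps)
  then show ?thesis unfolding eq .
qed

lemma partial_radial:
  fixes x :: "real^'n"
  assumes "x \<noteq> 0" "(\<phi> has_real_derivative D) (at (norm x))"
  shows "partial i (\<lambda>z. \<phi> (norm z)) x = D * (x $ i / norm x)"
proof -
  have "((\<lambda>t. \<phi> (norm (x + t *\<^sub>R axis i 1))) has_real_derivative D * (x $ i / norm x)) (at 0)"
    by (rule DERIV_chain2[where g = "\<lambda>t. norm (x + t *\<^sub>R axis i 1)"])
      (use assms norm_axis_derivative in auto)
  then show ?thesis unfolding partial_def by (rule DERIV_imp_deriv)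
qed

text \<open>If \<psi> is the derivative of a radial profile, \<open>g\<close> is component
  \<open>i\<close> of minus the gradient, and the result is an entry of minus the Hessian: radial
  curvature along \<open>x\<close>, slope over radius across it.\<close>

lemma partial_radial_vector_field:
  fixes x :: "real^'n" and \<psi> :: "real \<Rightarrow> real"
  assumes "x \<noteq> 0" "(\<psi> has_real_derivative D) (at (norm x))"
    and g: "\<And>y. y \<noteq> 0 \<Longrightarrow> g y = - \<psi> (norm y) * (y $ i / norm y)"
  shows "partial j g x = - D * Pr_par x $ j $ i - \<psi> (norm x) / norm x * Pr_perp x $ j $ i"
proof -
  let ?l = "\<lambda>t. x + t *\<^sub>R axis j 1"
  have n: "norm x \<noteq> 0" using assms by simp
  have d1: "((\<lambda>t. \<psi> (norm (?l t))) has_real_derivative D * (x $ j / norm x)) (at 0)"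
    by (rule DERIV_chain2[where g = "\<lambda>t. norm (?l t)"])
      (use assms norm_axis_derivative in auto)
  have d2: "((\<lambda>t. ?l t $ i) has_real_derivative (if j = i then 1 else 0)) (at 0)"
    by (auto intro!: derivative_eq_intros simp: axis_def)
  note d3 = norm_axis_derivative[OF assms(1), of j]
  have "((\<lambda>t. - \<psi> (norm (?l t)) * (?l t $ i / norm (?l t))) has_real_derivative
      - (D * (x $ j / norm x)) * (x $ i / norm x) + - \<psi> (norm x) *
       (((if j = i then 1 else 0) * norm x - x $ i * (x $ j / norm x)) / (norm x * norm x))) (at 0)"
    using DERIV_mult[OF DERIV_minus[OF d1] DERIV_divide[OF d2 d3]] n
    by (simp add: algebra_simps)
  \<comment> \<open>The formula for \<open>g\<close> is known only off the origin, which the line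
    through \<open>x\<close> avoids for small \<open>t\<close>.\<close>
  moreover have "eventually (\<lambda>t. - \<psi> (norm (?l t)) * (?l t $ i / norm (?l t)) = g (?l t)) (nhds 0)"
  proof -
    have "((\<lambda>t. ?l t) \<longlongrightarrow> ?l 0) (nhds 0)" by (intro tendsto_intros filterlim_ident)
    then have "eventually (\<lambda>t. ?l t \<noteq> 0) (nhds 0)"
      using assms(1) by (intro tendsto_imp_eventually_ne) auto
    then show ?thesis by eventually_elim (simp add: g)
  qed
  ultimately have "((\<lambda>t. g (?l t)) has_real_derivative
      - (D * (x $ j / norm x)) * (x $ i / norm x) + - \<psi> (norm x) *
       (((if j = i then 1 else 0) * norm x - x $ i * (x $ j / norm x)) / (norm x * norm x))) (at 0)"
    by (rule DERIV_cong_ev[OF refl _ refl, THEN iffD1, rotated])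
  then have "partial j g x = - (D * (x $ j / norm x)) * (x $ i / norm x) + - \<psi> (norm x) *
       (((if j = i then 1 else 0) * norm x - x $ i * (x $ j / norm x)) / (norm x * norm x))"
    unfolding partial_def by (rule DERIV_imp_deriv)
  also have "\<dots> = - D * Pr_par x $ j $ i - \<psi> (norm x) / norm x * Pr_perp x $ j $ i"
    using n by (simp add: Pr_perp_def Pr_par_def mat_def power2_eq_square field_simps)
  finally show ?thesis .
qed


section \<open>Rotation invariance\<close>

text \<open>Rank-one form, which lets matrix identities be checked by their action on
  vectors.\<close>

lemma Pr_par_vector: "Pr_par x *v v = ((x \<bullet> v) / (norm x)\<^sup>2) *\<^sub>R x"
  by (simp add: vec_eq_iff Pr_par_def matrix_vector_mult_def inner_vec_def sum_distrib_left
      sum_divide_distrib mult_ac)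

text \<open>\<open>matrix_inv\<close> chooses some two-sided inverse; the transpose is one, and
  inverses are unique.\<close>

lemma matrix_inv_orthogonal:
  fixes R :: "real^'n^'n"
  assumes "orthogonal_matrix R"
  shows "matrix_inv R = transpose R"
proof -
  have "R ** transpose R = mat 1 \<and> transpose R ** R = mat 1"
    using assms by (simp add: orthogonal_matrix_def)
  then have "R ** matrix_inv R = mat 1 \<and> matrix_inv R ** R = mat 1"
    unfolding matrix_inv_def by (rule someI)
  then show ?thesis
    using assms by (metis matrix_mul_assoc matrix_mul_lid matrix_mul_rid orthogonal_matrix_def)
qed

lemma norm_orthogonal_matrix:
  fixes R :: "real^'n^'n"
  assumes "orthogonal_matrix R"
  shows "norm (R *v x) = norm x"
  using assms orthogonal_transformation_norm[of "(*v) R" x] orthogonal_transformation_matrix[of "(*v) R"]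
  by simp

text \<open>\<open>R\<close> preserves the norm, and its transpose moves to the other side of the
  inner product in \<open>Pr_par_vector\<close>.\<close>

lemma Pr_par_rotate:
  fixes R :: "real^'n^'n"
  assumes "orthogonal_matrix R"
  shows "Pr_par (R *v x) = R ** Pr_par x ** transpose R"
proof -
  have "(R *v x) \<bullet> v = x \<bullet> (v v* R)" for v
    using dot_lmul_matrix[of v R x] by (simp add: inner_commute)
  then have "Pr_par (R *v x) *v v = (R ** Pr_par x ** transpose R) *v v" for v
    by (simp add: Pr_par_vector norm_orthogonal_matrix[OF assms]
        matrix_vector_mult_scaleR flip: matrix_vector_mul_assoc)
  then show ?thesis by (simp add: matrix_eq)
qed

lemma TRI_radial_projections:
  fixes k :: "real^'n \<Rightarrow> real^'n^'n"
  assumes cont: "continuous_on UNIV k"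
    and k: "\<And>x. x \<noteq> 0 \<Longrightarrow> k x = a (norm x) *\<^sub>R Pr_par x + b (norm x) *\<^sub>R Pr_perp x"
  shows "TRI k"
  unfolding TRI_def
proof (intro allI impI)
  fix x :: "real^'n" and R :: "real^'n^'n"
  assume R: "orthogonal_matrix R"
  let ?l = "\<lambda>x. k (R *v x)" and ?r = "\<lambda>x. R ** k x ** transpose R"
  have off: "?l y = ?r y" if "y \<noteq> 0" for y
  proof -
    have ne: "R *v y \<noteq> 0" using that norm_orthogonal_matrix[OF R, of y] by auto
    \<comment> \<open>Handles the identity matrix inside \<open>Pr_perp\<close>;
      \<open>v v* R\<close> is the transpose of \<open>R\<close> applied to
      \<open>v\<close>.\<close>
    have RR: "R *v (v v* R) = v" for v
      using R matrix_vector_mul_assoc[of R "transpose R" v] by (simp add: orthogonal_matrix_def)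
    have "?l y *v v = ?r y *v v" for v
      by (simp add: k[OF that] k[OF ne] Pr_perp_def norm_orthogonal_matrix[OF R] Pr_par_rotate[OF R]
          matrix_vector_mult_add_rdistrib matrix_vector_mult_diff_rdistrib
          matrix_vector_right_distrib matrix_vector_mult_diff_distrib matrix_vector_mult_scaleR RR
          flip: scaleR_matrix_vector_assoc matrix_vector_mul_assoc)
    then show ?thesis by (simp add: matrix_eq)
  qed
  have lin: "continuous_on UNIV (\<lambda>x. R *v x)" by (intro linear_continuous_on matrix_vector_mul_bounded_linear)
  have "continuous_on UNIV ?l"
    by (rule continuous_on_compose2[OF cont lin]) simp
  moreover have "continuous_on UNIV ?r"
    unfolding matrix_matrix_mult_def by (intro continuous_intros cont)
  ultimately have cont_diff: "continuous_on UNIV (\<lambda>x. ?l x - ?r x)" by (intro continuous_intros)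
  \<comment> \<open>The projection formula says nothing about \<open>k 0\<close>, so the value is
    obtained as the limit of a difference that vanishes off 0.\<close>
  have "?l 0 - ?r 0 = 0"
  proof (rule tendsto_unique[of "at 0"])
    show "((\<lambda>x. ?l x - ?r x) \<longlongrightarrow> ?l 0 - ?r 0) (at 0)"
      using cont_diff unfolding continuous_on_eq_continuous_at[OF open_UNIV] isCont_def by blast
    show "((\<lambda>x. ?l x - ?r x) \<longlongrightarrow> 0) (at 0)"
      by (rule Lim_transform_eventually[OF tendsto_const])
        (auto simp: eventually_at off intro: exI[of _ 1])
  qed simp
  then show "k (R *v x) = R ** k x ** matrix_inv R"
    using off[of x] by (cases "x = 0") (auto simp: matrix_inv_orthogonal[OF R])
qed

text \<open>Existence suffices: by \<open>hilbert_function_space_gradient\<close> and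
  \<open>matrix_reproducing_kernel_unique\<close>, every reproducing kernel of the gradient space
  equals this one.\<close>

theorem proposition4p4:
  fixes H :: "(real^'n \<Rightarrow> real) set"
    and ip :: "(real^'n \<Rightarrow> real) \<Rightarrow> (real^'n \<Rightarrow> real) \<Rightarrow> real"
    and s :: nat and k_H :: "real \<Rightarrow> real"
  assumes "2 \<le> CARD('n)" and "1 \<le> s"
    and "hilbert_function_space H ip"
    and "embeds_in_C0 s H ip"
    and "scalar_reproducing_kernel H ip (\<lambda>x y. k_H (norm (x - y)))"
  shows "\<exists>(k_V :: real^'n \<Rightarrow> real^'n^'n) k_par k_perp.
           matrix_reproducing_kernel (gradient ` H) (gradient_ip H ip) (\<lambda>x y. k_V (x - y)) \<and>
           TRI k_V \<and>
           (\<forall>x. x \<noteq> 0 \<longrightarrow>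
              k_V x = k_par (norm x) *\<^sub>R Pr_par x + k_perp (norm x) *\<^sub>R Pr_perp x) \<and>
           (\<forall>r>0. k_H differentiable (at r) \<and> deriv k_H differentiable (at r) \<and>
              k_par r = - deriv (deriv k_H) r \<and> k_perp r = - (1 / r) * deriv k_H r)"
proof -
  interpret hilbert_function_space H ip by fact
  have sub: "H \<subseteq> C0 s" using assms(4) by (simp add: embeds_in_C0_def)
  then have C: "f \<in> C0 s" if "f \<in> H" for f using that by blast
  define k :: "real^'n \<Rightarrow> real" where "k z = k_H (norm z)" for z
  have ker: "(\<lambda>z. k (z - y)) \<in> H" "f \<in> H \<Longrightarrow> ip (\<lambda>z. k (z - y)) f = f y" for y f
    using assms(5) by (auto simp: scalar_reproducing_kernel_def k_def)
  have k: "k \<in> H" using ker(1)[of 0] by simp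
  have "\<exists>G. G \<in> H \<and> (\<forall>f\<in>H. ip G f = \<alpha> \<bullet> gradient f x)" for \<alpha> x
    using gradient_representer[OF assms(3,4,2), of \<alpha> x] by metis
  then obtain G where G: "\<And>\<alpha> x. G \<alpha> x \<in> H"
      "\<And>\<alpha> x f. f \<in> H \<Longrightarrow> ip (G \<alpha> x) f = \<alpha> \<bullet> gradient f x"
    by metis
  \<comment> \<open>Pairing the representer with the kernel function at \<open>y\<close> gives its
    value at \<open>y\<close> on one side and a derivative of that kernel function on the
    other.\<close>
  have G_eq: "G \<alpha> x y = (\<Sum>i\<in>UNIV. \<alpha> $ i * partial i k (x - y))" for \<alpha> x y
  proof -
    have "G \<alpha> x y = \<alpha> \<bullet> gradient (\<lambda>z. k (z - y)) x"
      using ker G ip_sym by metis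
    then show ?thesis by (simp add: inner_vec_def gradient_def partial_translate)
  qed
  \<comment> \<open>Representers of the partial derivatives at the origin. Each is a first
    derivative of \<open>k\<close>, reflected, and lies in \<open>H\<close>, so it can be
    differentiated once more; all other \<open>G\<close> are combinations of its translates.\<close>
  define g where "g i = G (axis i 1) 0" for i
  have g: "g i \<in> H" for i by (simp add: g_def G)
  have g_eq: "g i y = partial i k (- y)" for i y
    by (simp add: g_def G_eq axis_def if_distrib[of "\<lambda>c. c * _"] cong: if_cong)
  have G_g: "G \<alpha> x = (\<lambda>y. \<Sum>i\<in>UNIV. \<alpha> $ i * g i (y - x))" for \<alpha> x
    by (simp add: fun_eq_iff G_eq g_eq)
  \<comment> \<open>Since \<open>g i y = partial i k (- y)\<close>, this is minus the Hessian of
    \<open>k\<close> at \<open>- x\<close>, hence at \<open>x\<close> because \<open>k\<close> is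
    even.\<close>
  define k_V :: "real^'n \<Rightarrow> real^'n^'n" where "k_V x = (\<chi> j i. partial j (g i) x)" for x

  \<comment> \<open>The gradient of the representer is the kernel section of \<open>k_V\<close> at
    \<open>x\<close>. The reproducing property then follows because \<open>gradient\<close>
    preserves inner products.\<close>
  have grad_G: "gradient (G \<alpha> x) = (\<lambda>y. k_V (y - x) *v \<alpha>)" for \<alpha> x
  proof -
    have "partial j (G \<alpha> x) y = (\<Sum>i\<in>UNIV. \<alpha> $ i * partial j (g i) (y - x))" for j y
    proof -
      have "((\<lambda>t. g i (y - x + t *\<^sub>R axis j 1)) has_real_derivative partial j (g i) (y - x)) (at 0)" for i
        using C0_axis(1)[OF C[OF g] assms(2), of i "y - x" j 0] by simp
      then have "((\<lambda>t. \<Sum>i\<in>UNIV. \<alpha> $ i * g i (y - x + t *\<^sub>R axis j 1)) has_real_derivative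
          (\<Sum>i\<in>UNIV. \<alpha> $ i * partial j (g i) (y - x))) (at 0)"
        by (intro DERIV_sum DERIV_cmult)
      then have "partial j (\<lambda>y. \<Sum>i\<in>UNIV. \<alpha> $ i * g i (y - x)) y
          = (\<Sum>i\<in>UNIV. \<alpha> $ i * partial j (g i) (y - x))"
        unfolding partial_def[of j "\<lambda>y. \<Sum>i\<in>UNIV. \<alpha> $ i * g i (y - x)"]
        by (intro DERIV_imp_deriv) (simp add: algebra_simps)
      then show ?thesis by (simp add: G_g)
    qed
    then show ?thesis
      by (simp add: gradient_def k_V_def matrix_vector_mult_def fun_eq_iff vec_eq_iff mult.commute)
  qed
  have rep: "matrix_reproducing_kernel (gradient ` H) (gradient_ip H ip) (\<lambda>x y. k_V (x - y))"
    unfolding matrix_reproducing_kernel_def grad_G[symmetric]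
    using G by (auto simp: gradient_ip_gradient[OF sub assms(2)])

  have "\<exists>i::'n. True" by simp
  \<comment> \<open>An arbitrary coordinate: on its positive half-axis \<open>k\<close> restricts to
    \<open>k_H\<close>, so derivatives of \<open>k_H\<close> can be read off there.\<close>
  then obtain e :: 'n where True by blast
  have d1: "(k_H has_real_derivative partial e k (r *\<^sub>R axis e 1)) (at r)" if "0 < r" for r
  proof -
    have "((\<lambda>t. k (t *\<^sub>R axis e 1)) has_real_derivative partial e k (r *\<^sub>R axis e 1)) (at r)"
      using C0_axis(1)[OF C[OF k] assms(2), of 0 e r] by simp
    moreover have "eventually (\<lambda>t. k (t *\<^sub>R axis e 1) = k_H t) (nhds r)"
      using eventually_nhds_in_open[of "{0<..}" r] that
      by (auto elim!: eventually_mono simp: k_def)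
    ultimately show ?thesis by (rule DERIV_cong_ev[OF refl _ refl, THEN iffD1, rotated])
  qed
  \<comment> \<open>On the negative half-axis \<open>g e\<close> takes the values of
    \<open>deriv k_H\<close> at the reflected points, so differentiability of \<open>g e\<close>
    gives the second derivative.\<close>
  have d2: "(deriv k_H has_real_derivative deriv (deriv k_H) r) (at r)" if "0 < r" for r
  proof -
    have "((\<lambda>t. g e (t *\<^sub>R axis e 1)) has_real_derivative partial e (g e) ((- r) *\<^sub>R axis e 1)) (at (- r))"
      using C0_axis(1)[OF C[OF g] assms(2), of e 0 e "- r"] by simp
    then have "((\<lambda>t. g e ((- t) *\<^sub>R axis e 1)) has_real_derivative - partial e (g e) ((- r) *\<^sub>R axis e 1)) (at r)"
      by (simp add: DERIV_mirror)
    moreover have "eventually (\<lambda>t. g e ((- t) *\<^sub>R axis e 1) = deriv k_H t) (nhds r)"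
      using eventually_nhds_in_open[of "{0<..}" r] that
      by (auto elim!: eventually_mono simp: g_eq DERIV_imp_deriv[OF d1])
    ultimately have "(deriv k_H has_real_derivative - partial e (g e) ((- r) *\<^sub>R axis e 1)) (at r)"
      by (rule DERIV_cong_ev[OF refl _ refl, THEN iffD1, rotated])
    then show ?thesis using DERIV_imp_deriv by metis
  qed
  have d1': "(k_H has_real_derivative deriv k_H r) (at r)" if "0 < r" for r
    using d1[OF that] DERIV_imp_deriv by metis
  \<comment> \<open>The minus sign comes from evaluating \<open>partial i k\<close> at
    \<open>- y\<close>.\<close>
  have g_radial: "g i y = - deriv k_H (norm y) * (y $ i / norm y)" if "y \<noteq> 0" for i y
    using partial_radial[of "- y" k_H "deriv k_H (norm y)" i] d1'[of "norm y"] that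
    by (simp add: g_eq k_def[abs_def])
  have k_V: "k_V x = (- deriv (deriv k_H) (norm x)) *\<^sub>R Pr_par x
      + (- (1 / norm x) * deriv k_H (norm x)) *\<^sub>R Pr_perp x" if "x \<noteq> 0" for x
    using partial_radial_vector_field[OF that d2 g_radial] that
    by (simp add: vec_eq_iff k_V_def)
  \<comment> \<open>The entries are first partial derivatives of members of \<open>C0 s\<close>;
    their continuity covers the origin in the rotation invariance.\<close>
  have "continuous_on UNIV k_V"
    unfolding k_V_def by (intro continuous_intros C0_partial_continuous[OF C[OF g] assms(2)])
  then have "TRI k_V"
    using k_V by (rule TRI_radial_projections[where a = "\<lambda>r. - deriv (deriv k_H) r"
          and b = "\<lambda>r. - (1 / r) * deriv k_H r"])
  with rep show ?thesis
  proof (intro exI conjI allI impI)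
    show "k_V x = (\<lambda>r. - deriv (deriv k_H) r) (norm x) *\<^sub>R Pr_par x
        + (\<lambda>r. - (1 / r) * deriv k_H r) (norm x) *\<^sub>R Pr_perp x" if "x \<noteq> 0" for x
      using k_V[OF that] .
    show "k_H differentiable (at r)" "deriv k_H differentiable (at r)" if "0 < r" for r
      using d1'[OF that] d2[OF that] unfolding real_differentiable_def by blast+
  qed simp_all
qed

end
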